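(* Let $F$ be a field of characteristic zero and let $\mathcal{A}$ be a KV-algebra over $F$. If $H^2(\mathcal{A},\mathcal{A})$ is trivial (i.e. $H^2(\mathcal{A},\mathcal{A})=0$), then $\mathcal{A}$ is formally rigid.
   Context: A KV-algebra over $F$ is an $F$-vector space $\mathcal{A}$ with a bilinear multiplication $(a,b)\mapsto ab$ such that the associator $(a,b,c)=(ab)c-a(bc)$ satisfies $(a,b,c)=(b,a,c)$ for all $a,b,c$. Write $|\mathcal{A}|$ for the underlying vector space. For $q\ge1$, $C_q(\mathcal{A},\mathcal{A})$ is the space of $q$-linear maps from $\mathcal{A}$ to $\mathcal{A}$, and $\delta:C_q(\mathcal{A},\mathcal{A})\to C_{q+1}(\mathcal{A},\mathcal{A})$ is $$(\delta f)(a_1,\dots,a_{q+1})=\sum_{j=1}^{q}(-1)^j\Big\{(a_jf)(a_1,\dots,\widehat{a_j},\dots,a_{q+1})+\big(f(a_1,\dots,\widehat{a_j},\dots,a_q,a_j)\big)a_{q+1}\Big\},$$ with $(af)(b_1,\dots,b_q)=a(f(b_1,\dots,b_q))-\sum_i f(b_1,\dots,ab_i,\dots,b_q)$. One has $\delta\circ\delta=0$, and $H^2(\mathcal{A},\mathcal{A})=\ker(\delta|_{C_2(\mathcal{A},\mathcal{A})})/\delta C_1(\mathcal{A},\mathcal{A})$. A formal deformation of $\mathcal{A}$ is a formal power series $\mu_t=\sum_{j\ge0}t^j\mu_j$ with $\mu_j:|\mathcal{A}|\times|\mathcal{A}|\to|\mathcal{A}|$ bilinear and $\mu_0(a,a')=aa'$,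 such that $\mu_t$ satisfies the KV identity $(a,b,c)_t=(b,a,c)_t$ identically in $t$, where $(a,b,c)_t=\mu_t(\mu_t(a,b),c)-\mu_t(a,\mu_t(b,c))$. $\mathcal{A}$ is formally rigid if every formal deformation $\mu_t$ is trivial, i.e. there is a formal power series $\phi_t=\mathrm{id}+\sum_{j\ge1}t^j\theta_j$ with $\theta_j$ linear endomorphisms of $|\mathcal{A}|$ such that $\mu_t(a,a')=\phi_t(\phi_t^{-1}(a)\,\phi_t^{-1}(a'))$. *)

theory Defs
  imports "HOL-Computational_Algebra.Formal_Power_Series"
begin

unbundle fps_syntax

locale kv_algebra = vector_space scale
  for scale :: "'f::field \<Rightarrow> 'v::ab_group_add \<Rightarrow> 'v" +
  fixes mul :: "'v \<Rightarrow> 'v \<Rightarrow> 'v"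
  assumes linear_mul_right: "Vector_Spaces.linear scale scale (\<lambda>b. mul a b)"
    and linear_mul_left: "Vector_Spaces.linear scale scale (\<lambda>a. mul a b)"
    and kv_identity:
      "mul (mul a b) c - mul a (mul b c) = mul (mul b a) c - mul b (mul a c)"
begin

subsection \<open>Cohomology\<close>

text \<open>A \<open>q\<close>-linear map is encoded as a function on lists that is linear in each
  entry of a list of length \<open>q\<close>. Its irrelevant values, on lists of any other length, are
  fixed to be zero, so that cochains are equal as functions iff they are equal as
  \<open>q\<close>-linear maps.\<close>

definition cochains :: "nat \<Rightarrow> ('v list \<Rightarrow> 'v) set" where
  "cochains q = {f.
     (\<forall>as j. length as = q \<and> j < q \<longrightarrow>
        Vector_Spaces.linear scale scale (\<lambda>x. f (as[j := x]))) \<and>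
     (\<forall>as. length as \<noteq> q \<longrightarrow> f as = 0)}"

definition act :: "'v \<Rightarrow> ('v list \<Rightarrow> 'v) \<Rightarrow> 'v list \<Rightarrow> 'v" where
  "act a f bs = mul a (f bs) - (\<Sum>i<length bs. f (bs[i := mul a (bs ! i)]))"

definition omit :: "nat \<Rightarrow> 'a list \<Rightarrow> 'a list" where
  "omit j as = take j as @ drop (Suc j) as"

text \<open>List positions start at 0, so \<open>as ! (j - 1)\<close> is the argument \<open>a\<^sub>j\<close> and \<open>as ! q\<close>
  is the last argument.\<close>

definition delta :: "nat \<Rightarrow> ('v list \<Rightarrow> 'v) \<Rightarrow> 'v list \<Rightarrow> 'v" where
  "delta q f as =
     (if length as = Suc q then
        (\<Sum>j=1..q. scale ((-1) ^ j)
           (act (as ! (j - 1)) f (omit (j - 1) as)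
            + mul (f (omit (j - 1) (take q as) @ [as ! (j - 1)])) (as ! q)))
      else 0)"

definition cocycles2 :: "('v list \<Rightarrow> 'v) set" where
  "cocycles2 = {f \<in> cochains 2. delta 2 f = (\<lambda>_. 0)}"

definition coboundaries2 :: "('v list \<Rightarrow> 'v) set" where
  "coboundaries2 = delta 1 ` cochains 1"

definition cohomologous2 :: "(('v list \<Rightarrow> 'v) \<times> ('v list \<Rightarrow> 'v)) set" where
  "cohomologous2 =
     {(f, g). f \<in> cocycles2 \<and> g \<in> cocycles2 \<and> (\<lambda>as. f as - g as) \<in> coboundaries2}"

definition H2 :: "('v list \<Rightarrow> 'v) set set" where
  "H2 = cocycles2 // cohomologous2"

definition H2_zero :: "('v list \<Rightarrow> 'v) set" where
  "H2_zero = cohomologous2 `` {\<lambda>_. 0}"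

subsection \<open>Formal deformations\<close>

text \<open>Formal power series with coefficients in \<open>|A|\<close>, in the linear endomorphisms of
  \<open>|A|\<close> and in the bilinear maps on \<open>|A|\<close> are all elements of the library type of formal
  power series. Series of linear or bilinear maps act on series of vectors by Cauchy
  products, and a vector is identified with the corresponding constant series.\<close>

definition fps_apply :: "('v \<Rightarrow> 'v) fps \<Rightarrow> 'v fps \<Rightarrow> 'v fps" where
  "fps_apply \<phi> x = Abs_fps (\<lambda>n. \<Sum>i\<le>n. (\<phi> $ i) (x $ (n - i)))"

definition fps_apply2 :: "('v \<Rightarrow> 'v \<Rightarrow> 'v) fps \<Rightarrow> 'v fps \<Rightarrow> 'v fps \<Rightarrow> 'v fps" where
  "fps_apply2 \<mu> x y =
     Abs_fps (\<lambda>n. \<Sum>i\<le>n. \<Sum>j\<le>n - i. (\<mu> $ i) (x $ j) (y $ (n - i - j)))"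

definition mul_series :: "'v fps \<Rightarrow> 'v fps \<Rightarrow> 'v fps" where
  "mul_series x y = Abs_fps (\<lambda>n. \<Sum>i\<le>n. mul (x $ i) (y $ (n - i)))"

definition associator_series :: "('v \<Rightarrow> 'v \<Rightarrow> 'v) fps \<Rightarrow> 'v fps \<Rightarrow> 'v fps \<Rightarrow> 'v fps \<Rightarrow> 'v fps" where
  "associator_series \<mu> x y z =
     fps_apply2 \<mu> (fps_apply2 \<mu> x y) z - fps_apply2 \<mu> x (fps_apply2 \<mu> y z)"

definition formal_deformation :: "('v \<Rightarrow> 'v \<Rightarrow> 'v) fps \<Rightarrow> bool" where
  "formal_deformation \<mu> \<longleftrightarrow>
     (\<forall>j. (\<forall>a. Vector_Spaces.linear scale scale (\<lambda>b. (\<mu> $ j) a b)) \<and>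
          (\<forall>b. Vector_Spaces.linear scale scale (\<lambda>a. (\<mu> $ j) a b))) \<and>
     \<mu> $ 0 = mul \<and>
     (\<forall>a b c. associator_series \<mu> (fps_const a) (fps_const b) (fps_const c)
            = associator_series \<mu> (fps_const b) (fps_const a) (fps_const c))"

definition formal_automorphism :: "('v \<Rightarrow> 'v) fps \<Rightarrow> bool" where
  "formal_automorphism \<phi> \<longleftrightarrow>
     \<phi> $ 0 = id \<and> (\<forall>j\<ge>1. Vector_Spaces.linear scale scale (\<phi> $ j))"

text \<open>The inverse series acts as the inverse map, which is a genuine inverse by
  \<open>bij_fps_apply\<close> below.\<close>

definition trivial_deformation :: "('v \<Rightarrow> 'v \<Rightarrow> 'v) fps \<Rightarrow> bool" where
  "trivial_deformation \<mu> \<longleftrightarrow>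
     (\<exists>\<phi>. formal_automorphism \<phi> \<and>
        (\<forall>a a'. fps_apply2 \<mu> (fps_const a) (fps_const a')
              = fps_apply \<phi> (mul_series (inv (fps_apply \<phi>) (fps_const a))
                                       (inv (fps_apply \<phi>) (fps_const a')))))"

definition formally_rigid :: bool where
  "formally_rigid \<longleftrightarrow> (\<forall>\<mu>. formal_deformation \<mu> \<longrightarrow> trivial_deformation \<mu>)"

subsection \<open>Basic properties\<close>

lemmas mul_add_right = module_hom.add[OF module_hom_iff_linear[THEN iffD2, OF linear_mul_right]]
lemmas mul_add_left = module_hom.add[OF module_hom_iff_linear[THEN iffD2, OF linear_mul_left]]
lemmas mul_diff_right = module_hom.diff[OF module_hom_iff_linear[THEN iffD2, OF linear_mul_right]]
lemmas mul_diff_left = module_hom.diff[OF module_hom_iff_linear[THEN iffD2, OF linear_mul_left]]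
lemmas mul_zero_right = module_hom.zero[OF module_hom_iff_linear[THEN iffD2, OF linear_mul_right]]
lemmas mul_zero_left = module_hom.zero[OF module_hom_iff_linear[THEN iffD2, OF linear_mul_left]]
lemmas mul_scale_right = module_hom.scale[OF module_hom_iff_linear[THEN iffD2, OF linear_mul_right]]
lemmas mul_scale_left = module_hom.scale[OF module_hom_iff_linear[THEN iffD2, OF linear_mul_left]]

lemma linear_scaleI:
  assumes "\<And>x y. f (x + y) = f x + f y" and "\<And>c x. f (scale c x) = scale c (f x)"
  shows "Vector_Spaces.linear scale scale f"
  unfolding Vector_Spaces.linear_iff using assms vector_space_axioms by blast

lemma delta_1: "delta 1 f [a, b] = f [mul a b] - mul a (f [b]) - mul (f [a]) b"
  by (simp add: delta_def act_def omit_def algebra_simps)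

lemma delta_2:
  "delta 2 f [a, b, c] =
     (mul (f [a, b]) c + f [mul a b, c] - mul a (f [b, c]) - f [a, mul b c])
     - (mul (f [b, a]) c + f [mul b a, c] - mul b (f [a, c]) - f [b, mul a c])"
proof -
  have "{1..2::nat} = {1, 2}" by auto
  then show ?thesis
    by (simp add: delta_def act_def omit_def algebra_simps numeral_2_eq_2 lessThan_Suc)
qed

lemma cochain_1_linear:
  assumes "f \<in> cochains 1"
  shows "Vector_Spaces.linear scale scale (\<lambda>x. f [x])"
proof -
  have "Vector_Spaces.linear scale scale (\<lambda>x. f ([0][0 := x]))"
    using assms unfolding cochains_def mem_Collect_eq
    by (elim conjE allE[of _ "[0]"] allE[of _ "0::nat"]) simp
  then show ?thesis by simp
qed

lemma delta_1_in_cochains: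
  assumes "f \<in> cochains 1"
  shows "delta 1 f \<in> cochains 2"
proof -
  interpret f: Vector_Spaces.linear scale scale "\<lambda>x. f [x]"
    by (rule cochain_1_linear[OF assms])
  have "Vector_Spaces.linear scale scale (\<lambda>x. delta 1 f (as[j := x]))"
    if len: "length as = 2" and j: "j < 2" for as j
  proof -
    obtain a b where as: "as = [a, b]"
      using len by (cases as; cases "tl as") auto
    consider "j = 0" | "j = 1" using j by linarith
    then show ?thesis
    proof cases
      case 1
      show ?thesis
        unfolding as 1
        by (rule linear_scaleI)
          (simp_all add: delta_1[unfolded One_nat_def] f.add f.scale mul_add_left mul_scale_left algebra_simps)
    next
      case 2
      show ?thesis
        unfolding as 2
        by (rule linear_scaleI)
          (simp_all add: delta_1[unfolded One_nat_def] f.add f.scale mul_add_right mul_scale_right algebra_simps)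
    qed
  qed
  then show ?thesis
    by (auto simp: cochains_def delta_def)
qed

lemma delta_delta_1:
  assumes "f \<in> cochains 1"
  shows "delta 2 (delta 1 f) = (\<lambda>_. 0)"
proof
  fix as
  interpret f: Vector_Spaces.linear scale scale "\<lambda>x. f [x]"
    by (rule cochain_1_linear[OF assms])
  show "delta 2 (delta 1 f) as = 0"
  proof (cases "length as = 3")
    case False
    then show ?thesis by (simp add: delta_def)
  next
    case True
    then obtain a b c where as: "as = [a, b, c]"
      unfolding numeral_3_eq_3 length_Suc_conv by auto
    have k1: "mul (mul a b) c = mul a (mul b c) + mul (mul b a) c - mul b (mul a c)" for a b c
      using kv_identity[of a b c] by (simp add: algebra_simps)
    have k2: "f [mul (mul a b) c] = f [mul a (mul b c)] + f [mul (mul b a) c] - f [mul b (mul a c)]"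
      by (subst k1) (simp add: f.add f.diff)
    show ?thesis
      unfolding as delta_2 delta_1 mul_diff_left mul_diff_right k2
        k1[of "f [a]" b c] k1[of a "f [b]" c] k1[of a b "f [c]"]
      by (simp add: algebra_simps)
  qed
qed

lemma coboundaries2_subset: "coboundaries2 \<subseteq> cocycles2"
  using delta_1_in_cochains delta_delta_1
  by (auto simp: coboundaries2_def cocycles2_def)

lemma delta_diff:
   "delta q (\<lambda>as. f as - g as) = (\<lambda>as. delta q f as - delta q g as)"
  by (rule ext) (auto simp: delta_def act_def mul_diff_left mul_diff_right sum_subtractf
      scale_right_diff_distrib scale_right_distrib algebra_simps sum.distrib)

lemma diff_in_cochains:
  assumes "f \<in> cochains q" "g \<in> cochains q"
  shows "(\<lambda>as. f as - g as) \<in> cochains q"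
  using assms by (auto simp: cochains_def Vector_Spaces.linear_iff algebra_simps)

lemma zero_in_cochains: "(\<lambda>_. 0) \<in> cochains q"
  using vector_space_axioms by (auto simp: cochains_def Vector_Spaces.linear_iff)

lemma delta_zero: "delta q (\<lambda>_. 0) = (\<lambda>_. 0)"
  by (rule ext) (simp add: delta_def act_def mul_zero_left mul_zero_right)

lemma zero_in_coboundaries2: "(\<lambda>_. 0) \<in> coboundaries2"
  using zero_in_cochains[of 1] delta_zero[of 1] unfolding coboundaries2_def
  by (metis image_eqI)

lemma diff_in_coboundaries2:
  assumes "f \<in> coboundaries2" "g \<in> coboundaries2"
  shows "(\<lambda>as. f as - g as) \<in> coboundaries2"
proof -
  obtain u v where "u \<in> cochains 1" "f = delta 1 u" "v \<in> cochains 1" "g = delta 1 v"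
    using assms unfolding coboundaries2_def by blast
  then show ?thesis
    unfolding coboundaries2_def
    by (intro image_eqI[of _ _ "\<lambda>as. u as - v as"] diff_in_cochains)
      (simp_all only: delta_diff)
qed

lemma equiv_cohomologous2: "equiv cocycles2 cohomologous2"
proof (rule equivI)
  show "cohomologous2 \<subseteq> cocycles2 \<times> cocycles2"
    by (auto simp: cohomologous2_def)
  show "refl_on cocycles2 cohomologous2"
    using zero_in_coboundaries2 by (auto simp: refl_on_def cohomologous2_def)
  show "sym cohomologous2"
  proof (rule symI)
    fix f g assume "(f, g) \<in> cohomologous2"
    then show "(g, f) \<in> cohomologous2"
      using diff_in_coboundaries2[OF zero_in_coboundaries2, of "\<lambda>as. f as - g as"]
      by (auto simp: cohomologous2_def)
  qed
  show "trans cohomologous2"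
  proof (rule transI)
    fix f g h assume "(f, g) \<in> cohomologous2" "(g, h) \<in> cohomologous2"
    moreover from this(2) have "(\<lambda>as. h as - g as) \<in> coboundaries2"
      using diff_in_coboundaries2[OF zero_in_coboundaries2, of "\<lambda>as. g as - h as"]
      by (auto simp: cohomologous2_def)
    ultimately show "(f, h) \<in> cohomologous2"
      using diff_in_coboundaries2[of "\<lambda>as. f as - g as" "\<lambda>as. h as - g as"]
      by (auto simp: cohomologous2_def)
  qed
qed

lemma H2_zero_eq: "H2_zero = coboundaries2"
proof -
  have "(\<lambda>as. - f as) \<in> coboundaries2 \<longleftrightarrow> f \<in> coboundaries2" for f
    using diff_in_coboundaries2[OF zero_in_coboundaries2, of f]
      diff_in_coboundaries2[OF zero_in_coboundaries2, of "\<lambda>as. - f as"] by auto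
  then show ?thesis
    using coboundaries2_subset zero_in_coboundaries2
    by (auto simp: H2_zero_def cohomologous2_def)
qed

fun fps_solve :: "('v \<Rightarrow> 'v) fps \<Rightarrow> 'v fps \<Rightarrow> nat \<Rightarrow> 'v" where
  "fps_solve \<phi> y n = y $ n - (\<Sum>i\<in>{1..n}. if 1 \<le> i \<and> i \<le> n then (\<phi> $ i) (fps_solve \<phi> y (n - i)) else 0)"

declare fps_solve.simps [simp del]

lemma fps_apply_nth:
  assumes "\<phi> $ 0 = id"
  shows "fps_apply \<phi> x $ n = x $ n + (\<Sum>i=1..n. (\<phi> $ i) (x $ (n - i)))"
proof -
  have "{..n} = insert 0 {1..n}" by auto
  then show ?thesis using assms by (simp add: fps_apply_def)
qed

lemma bij_fps_apply:
  assumes "formal_automorphism \<phi>"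
  shows "bij (fps_apply \<phi>)"
proof (rule bijI)
  have \<phi>0: "\<phi> $ 0 = id" using assms by (simp add: formal_automorphism_def)
  show "inj (fps_apply \<phi>)"
  proof (rule injI)
    fix x y assume eq: "fps_apply \<phi> x = fps_apply \<phi> y"
    have "x $ n = y $ n" for n
    proof (induction n rule: less_induct)
      case (less n)
      have "(\<Sum>i=1..n. (\<phi> $ i) (x $ (n - i))) = (\<Sum>i=1..n. (\<phi> $ i) (y $ (n - i)))"
        by (rule sum.cong) (auto simp: less.IH)
      then show ?case
        using arg_cong[OF eq, of "\<lambda>z. z $ n"] by (simp add: fps_apply_nth[OF \<phi>0])
    qed
    then show "x = y" by (simp add: fps_eq_iff)
  qed
  have "fps_apply \<phi> (Abs_fps (fps_solve \<phi> y)) = y" for y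
  proof (rule fps_ext)
    fix n
    have "fps_solve \<phi> y n = y $ n - (\<Sum>i=1..n. (\<phi> $ i) (fps_solve \<phi> y (n - i)))"
      by (subst fps_solve.simps) (auto intro!: sum.cong)
    then show "fps_apply \<phi> (Abs_fps (fps_solve \<phi> y)) $ n = y $ n"
      by (simp add: fps_apply_nth[OF \<phi>0])
  qed
  then show "surj (fps_apply \<phi>)" by (rule surjI)
qed

end

end

theory Submission
  imports Defs
begin

text \<open>The idea is to solve \<open>\<mu>\<^sub>t(\<phi>\<^sub>t a, \<phi>\<^sub>t b) = \<phi>\<^sub>t(a b)\<close> for
  \<open>\<phi>\<^sub>t = id + t \<theta>\<^sub>1 + t^2 \<theta>\<^sub>2 + \<dots>\<close> one power of \<open>t\<close> at a time. Suppose that the equation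
  holds below degree \<open>n\<close> and let \<open>\<psi>\<close> be the truncation \<open>id + \<dots> + t^(n-1) \<theta>\<^sub>n\<^sub>-\<^sub>1\<close>. Then
    \<open>\<mu>\<^sub>t(\<psi> a, \<psi> b) = \<psi>(a b) + t^n E(a, b) + \<dots>\<close>
  with a bilinear map \<open>E\<close>, the obstruction. Adding \<open>t^n \<theta>\<^sub>n\<close> to \<open>\<psi>\<close> changes the coefficient of
  \<open>t^n\<close> on the left by \<open>\<theta>\<^sub>n a \<cdot> b + a \<cdot> \<theta>\<^sub>n b\<close> and on the right by \<open>\<theta>\<^sub>n(a b)\<close>, so the equation in
  degree \<open>n\<close> says exactly that \<open>E = \<delta> \<theta>\<^sub>n\<close>.

  The obstruction is always a cocycle (\<open>obstruction_in_cocycles2\<close>). The coefficient of \<open>t^n\<close> in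
  \<open>\<mu>\<^sub>t(\<mu>\<^sub>t(\<psi> a, \<psi> b), \<psi> c) - \<mu>\<^sub>t(\<psi> a, \<mu>\<^sub>t(\<psi> b, \<psi> c))\<close> is
    \<open>E(a b, c) + E(a, b) c - E(a, b c) - a E(b, c)\<close>,
  and the KV identity for \<open>\<mu>\<^sub>t\<close>, applied to the series \<open>\<psi> a, \<psi> b, \<psi> c\<close>, makes it symmetric in \<open>a\<close>
  and \<open>b\<close>; this symmetry is the equation \<open>\<delta> E = 0\<close>. When the cohomology vanishes, \<open>E\<close> is therefore a
  coboundary, \<open>\<theta>\<^sub>n\<close> exists, and dependent choice yields the whole series
  (\<open>ex_deformation_steps\<close>).

  Two equations are known for constant series and needed for all series: the KV identity of
  \<open>\<mu>\<^sub>t\<close>, and the final equation for \<open>\<phi>\<^sub>t\<close>, into which \<open>\<phi>\<^sub>t\<^sup>-\<^sup>1 a\<close> and \<open>\<phi>\<^sub>t\<^sup>-\<^sup>1 b\<close> are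
  substituted. Both extend because all operations are additive and commute with multiplication
  by \<open>t\<close> (\<open>fps_maps_eqI\<close>).\<close>

section \<open>Series of vectors and multiplication by the formal variable\<close>

text \<open>Multiplication by \<open>t\<close>. It cannot be written as a product with \<open>fps_X\<close>, because the
  coefficients are vectors and have no product.\<close>
definition fps_up :: "'a::zero fps \<Rightarrow> 'a fps" where
  "fps_up x = Abs_fps (\<lambda>n. case n of 0 \<Rightarrow> 0 | Suc m \<Rightarrow> x $ m)"

lemma fps_up_nth_0 [simp]: "fps_up x $ 0 = 0"
  and fps_up_nth_Suc [simp]: "fps_up x $ Suc n = x $ n"
  by (simp_all add: fps_up_def)

lemma fps_up_diff: "fps_up (x - y) = fps_up x - fps_up (y :: 'a::ab_group_add fps)"
  by (rule fps_ext) (simp add: fps_up_def split: nat.split)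

lemma fps_const_plus_up: "x = fps_const (x $ 0) + fps_up (fps_shift 1 x)"
  for x :: "'a::ab_group_add fps"
  by (rule fps_ext) (simp add: fps_up_def split: nat.split)

text \<open>Write \<open>x = x\<^sub>0 + t x'\<close>. The hypotheses reduce the coefficient of degree \<open>n + 1\<close> at \<open>x\<close> to the
  coefficient of degree \<open>n\<close> at \<open>x'\<close>, so an induction on the degree suffices, and neither
  infinite sums nor a topology on series are involved.\<close>
lemma fps_maps_eqI:
  fixes D D' :: "'a::ab_group_add fps \<Rightarrow> 'a fps"
  assumes "\<And>x y. D (x + y) = D x + D y" "\<And>x. D (fps_up x) = fps_up (D x)"
    and "\<And>x y. D' (x + y) = D' x + D' y" "\<And>x. D' (fps_up x) = fps_up (D' x)"
    and "\<And>a. D (fps_const a) = D' (fps_const a)"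
  shows "D x = D' x"
proof -
  have split: "D x = D' (fps_const (x $ 0)) + fps_up (D (fps_shift 1 x))"
    "D' x = D' (fps_const (x $ 0)) + fps_up (D' (fps_shift 1 x))" for x
    using assms fps_const_plus_up[of x] by metis+
  have "D x $ n = D' x $ n" for n
  proof (induction n arbitrary: x)
    case 0
    show ?case by (subst split(1), subst split(2)) simp
  next
    case (Suc n)
    show ?case by (subst split(1), subst split(2)) (simp add: Suc)
  qed
  then show ?thesis by (simp add: fps_eq_iff)
qed

context kv_algebra
begin

section \<open>Bilinear operations on series\<close>

definition bilinear_series :: "('v \<Rightarrow> 'v \<Rightarrow> 'v) fps \<Rightarrow> bool" where
  "bilinear_series \<mu> \<longleftrightarrow>
     (\<forall>j. (\<forall>a. Vector_Spaces.linear scale scale (\<lambda>b. (\<mu> $ j) a b)) \<and>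
          (\<forall>b. Vector_Spaces.linear scale scale (\<lambda>a. (\<mu> $ j) a b)))"

context
  fixes \<mu> :: "('v \<Rightarrow> 'v \<Rightarrow> 'v) fps"
  assumes bilinear: "bilinear_series \<mu>"
begin

lemma coeff_linear_right: "Vector_Spaces.linear scale scale (\<lambda>b. (\<mu> $ j) a b)"
  and coeff_linear_left: "Vector_Spaces.linear scale scale (\<lambda>a. (\<mu> $ j) a b)"
  using bilinear by (auto simp: bilinear_series_def)

lemma coeff_add_right: "(\<mu> $ j) a (b + c) = (\<mu> $ j) a b + (\<mu> $ j) a c"
  and coeff_scale_right: "(\<mu> $ j) a (scale r b) = scale r ((\<mu> $ j) a b)"
  and coeff_add_left: "(\<mu> $ j) (b + c) a = (\<mu> $ j) b a + (\<mu> $ j) c a"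
  and coeff_scale_left: "(\<mu> $ j) (scale r b) a = scale r ((\<mu> $ j) b a)"
  using coeff_linear_right coeff_linear_left by (auto simp: Vector_Spaces.linear_iff)

lemma coeff_zero_right: "(\<mu> $ j) a 0 = 0" and coeff_zero_left: "(\<mu> $ j) 0 a = 0"
  using coeff_add_right[of j a 0 0] coeff_add_left[of j 0 0 a] by auto

lemma fps_apply2_add_left: "fps_apply2 \<mu> (x + y) z = fps_apply2 \<mu> x z + fps_apply2 \<mu> y z"
  and fps_apply2_add_right: "fps_apply2 \<mu> z (x + y) = fps_apply2 \<mu> z x + fps_apply2 \<mu> z y"
  by (rule fps_ext; simp add: fps_apply2_def coeff_add_left coeff_add_right sum.distrib)+

lemma fps_apply2_up_left: "fps_apply2 \<mu> (fps_up x) y = fps_up (fps_apply2 \<mu> x y)"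
proof (rule fps_ext)
  fix n
  show "fps_apply2 \<mu> (fps_up x) y $ n = fps_up (fps_apply2 \<mu> x y) $ n"
  proof (cases n)
    case (Suc m)
    have "(\<Sum>j\<le>Suc m - i. (\<mu> $ i) (fps_up x $ j) (y $ (Suc m - i - j)))
        = (\<Sum>j\<le>m - i. (\<mu> $ i) (x $ j) (y $ (m - i - j)))" if "i \<le> m" for i
      using that by (simp add: Suc_diff_le sum.atMost_Suc_shift coeff_zero_left del: sum.atMost_Suc)
    then show ?thesis
      by (simp add: Suc fps_apply2_def coeff_zero_left)
  qed (simp add: fps_apply2_def coeff_zero_left)
qed

lemma fps_apply2_up_right: "fps_apply2 \<mu> x (fps_up y) = fps_up (fps_apply2 \<mu> x y)"
proof (rule fps_ext)
  fix n
  show "fps_apply2 \<mu> x (fps_up y) $ n = fps_up (fps_apply2 \<mu> x y) $ n"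
  proof (cases n)
    case (Suc m)
    have "(\<Sum>j\<le>Suc m - i. (\<mu> $ i) (x $ j) (fps_up y $ (Suc m - i - j)))
        = (\<Sum>j\<le>m - i. (\<mu> $ i) (x $ j) (y $ (m - i - j)))" if "i \<le> m" for i
      using that by (simp add: Suc_diff_le coeff_zero_right)
    then show ?thesis
      by (simp add: Suc fps_apply2_def coeff_zero_right)
  qed (simp add: fps_apply2_def coeff_zero_right)
qed

lemma fps_apply2_nth_low_left:
  assumes "\<And>k. k < n \<Longrightarrow> d $ k = 0"
  shows "fps_apply2 \<mu> d y $ n = (\<mu> $ 0) (d $ n) (y $ 0)"
proof -
  have "(\<Sum>j\<le>n - i. (\<mu> $ i) (d $ j) (y $ (n - i - j)))
      = (if i = 0 then (\<mu> $ 0) (d $ n) (y $ 0) else 0)" if "i \<le> n" for i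
  proof -
    have "(\<Sum>j\<le>n - i. (\<mu> $ i) (d $ j) (y $ (n - i - j)))
      = (\<Sum>j\<le>n - i. if j = n then (\<mu> $ i) (d $ n) (y $ 0) else 0)"
      by (rule sum.cong) (use assms in \<open>auto simp: coeff_zero_left\<close>)
    also have "\<dots> = (if i = 0 then (\<mu> $ 0) (d $ n) (y $ 0) else 0)"
      using that by (cases "n - i < n") auto
    finally show ?thesis .
  qed
  then show ?thesis by (simp add: fps_apply2_def)
qed

lemma fps_apply2_nth_low_right:
  assumes "\<And>k. k < n \<Longrightarrow> d $ k = 0"
  shows "fps_apply2 \<mu> x d $ n = (\<mu> $ 0) (x $ 0) (d $ n)"
proof -
  have "(\<Sum>j\<le>n - i. (\<mu> $ i) (x $ j) (d $ (n - i - j)))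
      = (if i = 0 then (\<mu> $ 0) (x $ 0) (d $ n) else 0)" if "i \<le> n" for i
  proof -
    have "(\<Sum>j\<le>n - i. (\<mu> $ i) (x $ j) (d $ (n - i - j)))
      = (\<Sum>j\<le>n - i. if j = 0 then (\<mu> $ i) (x $ 0) (d $ (n - i)) else 0)"
      by (rule sum.cong) (use assms in \<open>auto simp: coeff_zero_right\<close>)
    also have "\<dots> = (if i = 0 then (\<mu> $ 0) (x $ 0) (d $ n) else 0)"
      using that assms by (auto simp: coeff_zero_right)
    finally show ?thesis .
  qed
  then show ?thesis by (simp add: fps_apply2_def)
qed

text \<open>Arguments that change only from degree \<open>n\<close> on influence the coefficient of degree \<open>n\<close> only
  through \<open>\<mu>\<^sub>0\<close> and the constant terms of the other argument. For \<open>n = 0\<close> the formula would need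
  \<open>x' $ 0\<close> in place of \<open>x $ 0\<close>.\<close>
lemma fps_apply2_nth_perturb:
  assumes "0 < n" and x: "\<And>k. k < n \<Longrightarrow> x $ k = x' $ k" and y: "\<And>k. k < n \<Longrightarrow> y $ k = y' $ k"
  shows "fps_apply2 \<mu> x y $ n = fps_apply2 \<mu> x' y' $ n
           + (\<mu> $ 0) (x $ n - x' $ n) (y $ 0) + (\<mu> $ 0) (x $ 0) (y $ n - y' $ n)"
proof -
  have "fps_apply2 \<mu> x y = fps_apply2 \<mu> (x - x') y + fps_apply2 \<mu> x' (y - y') + fps_apply2 \<mu> x' y'"
    using fps_apply2_add_left[of "x - x'" x' y] fps_apply2_add_right[of x' "y - y'" y'] by simp
  moreover have "fps_apply2 \<mu> (x - x') y $ n = (\<mu> $ 0) (x $ n - x' $ n) (y $ 0)"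
    using x by (simp add: fps_apply2_nth_low_left)
  moreover have "fps_apply2 \<mu> x' (y - y') $ n = (\<mu> $ 0) (x $ 0) (y $ n - y' $ n)"
    using y x[of 0] \<open>0 < n\<close> by (simp add: fps_apply2_nth_low_right)
  ultimately show ?thesis by simp
qed

end

lemma formal_deformationD:
  assumes "formal_deformation \<mu>"
  shows "bilinear_series \<mu>" "\<mu> $ 0 = mul"
  using assms by (auto simp: formal_deformation_def bilinear_series_def)

text \<open>The KV identity of a deformation is assumed for constant series only. It extends to one
  argument after the other.\<close>
lemma associator_series_swap:
  assumes "formal_deformation \<mu>"
  shows "associator_series \<mu> x y z = associator_series \<mu> y x z"
proof -
  note \<mu> = formal_deformationD(1)[OF assms]
  note simps = associator_series_def fps_apply2_add_left[OF \<mu>] fps_apply2_add_right[OF \<mu>]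
    fps_apply2_up_left[OF \<mu>] fps_apply2_up_right[OF \<mu>] fps_up_diff
  have linear:
    "associator_series \<mu> (x + x') y z = associator_series \<mu> x y z + associator_series \<mu> x' y z"
    "associator_series \<mu> x (y + y') z = associator_series \<mu> x y z + associator_series \<mu> x y' z"
    "associator_series \<mu> x y (z + z') = associator_series \<mu> x y z + associator_series \<mu> x y z'"
    "associator_series \<mu> (fps_up x) y z = fps_up (associator_series \<mu> x y z)"
    "associator_series \<mu> x (fps_up y) z = fps_up (associator_series \<mu> x y z)"
    "associator_series \<mu> x y (fps_up z) = fps_up (associator_series \<mu> x y z)" for x x' y y' z z'
    by (simp_all add: simps)
  have 1: "associator_series \<mu> (fps_const a) (fps_const b) z
      = associator_series \<mu> (fps_const b) (fps_const a) z" for a b z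
    by (rule fps_maps_eqI[of "associator_series \<mu> (fps_const a) (fps_const b)"], rule linear,
        rule linear, rule linear, rule linear) (use assms in \<open>simp add: formal_deformation_def\<close>)
  have 2: "associator_series \<mu> (fps_const a) y z = associator_series \<mu> y (fps_const a) z" for a y z
    by (rule fps_maps_eqI[of "\<lambda>y. associator_series \<mu> (fps_const a) y z"], rule linear,
        rule linear, rule linear, rule linear, rule 1)
  show ?thesis
    by (rule fps_maps_eqI[of "\<lambda>x. associator_series \<mu> x y z"], rule linear,
        rule linear, rule linear, rule linear, rule 2)
qed

section \<open>The obstruction cocycle\<close>

definition truncated_image :: "(nat \<Rightarrow> 'v \<Rightarrow> 'v) \<Rightarrow> nat \<Rightarrow> 'v \<Rightarrow> 'v fps" where
  "truncated_image \<theta> n a = Abs_fps (\<lambda>k. if k < n then \<theta> k a else 0)"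

lemma truncated_image_nth: "truncated_image \<theta> n a $ k = (if k < n then \<theta> k a else 0)"
  by (simp add: truncated_image_def)

text \<open>Since \<open>truncated_image\<close> stops below degree \<open>n\<close>, this is the coefficient of \<open>t^n\<close> in
  \<open>\<mu>\<^sub>t(\<psi> a, \<psi> b) - \<psi>(a b)\<close> for \<open>\<psi> = \<Sum>k<n. t^k \<theta>\<^sub>k\<close>.\<close>
definition obstruction :: "('v \<Rightarrow> 'v \<Rightarrow> 'v) fps \<Rightarrow> (nat \<Rightarrow> 'v \<Rightarrow> 'v) \<Rightarrow> nat \<Rightarrow> 'v list \<Rightarrow> 'v" where
  "obstruction \<mu> \<theta> n as =
     (if length as = 2
      then fps_apply2 \<mu> (truncated_image \<theta> n (as ! 0)) (truncated_image \<theta> n (as ! 1)) $ n else 0)"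

lemma obstruction_pair:
  "obstruction \<mu> \<theta> n [a, b] = fps_apply2 \<mu> (truncated_image \<theta> n a) (truncated_image \<theta> n b) $ n"
  by (simp add: obstruction_def)

lemma obstruction_in_cochains:
  assumes \<mu>: "bilinear_series \<mu>"
    and lin: "\<And>m. m < n \<Longrightarrow> Vector_Spaces.linear scale scale (\<theta> m)"
  shows "obstruction \<mu> \<theta> n \<in> cochains 2"
proof -
  have \<theta>: "\<theta> m (u + v) = \<theta> m u + \<theta> m v" "\<theta> m (scale c u) = scale c (\<theta> m u)" if "m < n" for m u v c
    using lin[OF that] by (auto simp: Vector_Spaces.linear_iff)
  have add: "truncated_image \<theta> n (u + v) = truncated_image \<theta> n u + truncated_image \<theta> n v" for u v
    by (rule fps_ext) (simp add: truncated_image_nth \<theta>)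
  have scale: "truncated_image \<theta> n (scale c u) $ k = scale c (truncated_image \<theta> n u $ k)" for c u k
    by (simp add: truncated_image_nth \<theta>)
  note simps = fps_apply2_add_left[OF \<mu>] fps_apply2_add_right[OF \<mu>]
  have "Vector_Spaces.linear scale scale (\<lambda>x. obstruction \<mu> \<theta> n (as[j := x]))"
    if len: "length as = 2" and j: "j < 2" for as j
  proof -
    obtain a b where as: "as = [a, b]"
      using len by (cases as; cases "tl as") auto
    have "Vector_Spaces.linear scale scale (\<lambda>x. obstruction \<mu> \<theta> n [x, b])"
      unfolding obstruction_pair
      by (rule linear_scaleI)
        (simp_all add: add simps, simp_all add: fps_apply2_def scale coeff_scale_left[OF \<mu>] scale_sum_right)
    moreover have "Vector_Spaces.linear scale scale (\<lambda>x. obstruction \<mu> \<theta> n [a, x])"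
      unfolding obstruction_pair
      by (rule linear_scaleI)
        (simp_all add: add simps, simp_all add: fps_apply2_def scale coeff_scale_right[OF \<mu>] scale_sum_right)
    ultimately show ?thesis
      using j as by (auto simp: less_2_cases_iff)
  qed
  then show ?thesis
    by (auto simp: cochains_def obstruction_def)
qed

text \<open>Below degree \<open>n\<close> the series \<open>\<mu>\<^sub>t(\<psi> a, \<psi> b)\<close> and \<open>\<psi>(a b)\<close> agree, and in degree \<open>n\<close> they differ by
  the obstruction. Replacing the inner products of the associator of \<open>\<psi> a, \<psi> b, \<psi> c\<close> accordingly
  turns the KV identity in degree \<open>n\<close> into the cocycle equation.\<close>
lemma obstruction_in_cocycles2:
  assumes \<mu>: "formal_deformation \<mu>" and "0 < n" and id: "\<theta> 0 = id"
    and lin: "\<And>m. m < n \<Longrightarrow> Vector_Spaces.linear scale scale (\<theta> m)"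
    and hom: "\<And>m a b. m < n \<Longrightarrow>
      fps_apply2 \<mu> (truncated_image \<theta> n a) (truncated_image \<theta> n b) $ m = \<theta> m (mul a b)"
  shows "obstruction \<mu> \<theta> n \<in> cocycles2"
proof -
  let ?X = "truncated_image \<theta> n" and ?E = "obstruction \<mu> \<theta> n"
  have X: "?X a $ 0 = a" "?X a $ n = 0" for a
    using \<open>0 < n\<close> id by (simp_all add: truncated_image_nth)
  have XX: "fps_apply2 \<mu> (?X a) (?X b) $ k = ?X (mul a b) $ k" if "k < n" for a b k
    using that by (simp add: hom truncated_image_nth)
  note perturb = fps_apply2_nth_perturb[OF formal_deformationD(1)[OF \<mu>] \<open>0 < n\<close>]
  have left: "fps_apply2 \<mu> (fps_apply2 \<mu> (?X a) (?X b)) (?X c) $ n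
      = ?E [mul a b, c] + mul (?E [a, b]) c" for a b c
    using perturb[of "fps_apply2 \<mu> (?X a) (?X b)" "?X (mul a b)" "?X c" "?X c"]
    by (simp add: XX X obstruction_pair formal_deformationD(2)[OF \<mu>] mul_zero_right)
  have right: "fps_apply2 \<mu> (?X a) (fps_apply2 \<mu> (?X b) (?X c)) $ n
      = ?E [a, mul b c] + mul a (?E [b, c])" for a b c
    using perturb[of "?X a" "?X a" "fps_apply2 \<mu> (?X b) (?X c)" "?X (mul b c)"]
    by (simp add: XX X obstruction_pair formal_deformationD(2)[OF \<mu>] mul_zero_left)
  have "delta 2 ?E as = 0" for as
  proof (cases "length as = 3")
    case True
    then obtain a b c where as: "as = [a, b, c]"
      unfolding numeral_3_eq_3 length_Suc_conv by auto
    have "associator_series \<mu> (?X a) (?X b) (?X c) $ n = associator_series \<mu> (?X b) (?X a) (?X c) $ n"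
      using associator_series_swap[OF \<mu>] by simp
    then show ?thesis
      unfolding as delta_2 by (simp add: associator_series_def left right algebra_simps)
  qed (simp add: delta_def)
  then show ?thesis
    using obstruction_in_cochains[OF formal_deformationD(1)[OF \<mu>] lin]
    by (auto simp: cocycles2_def)
qed

section \<open>Construction of the trivializing series\<close>

lemma cocycle_is_coboundary:
  assumes "H2 = {H2_zero}" and f: "f \<in> cocycles2"
  shows "f \<in> coboundaries2"
proof -
  have "cohomologous2 `` {f} = H2_zero"
    using quotientI[OF f, of cohomologous2] assms(1) by (auto simp: H2_def)
  then show ?thesis
    using equiv_class_self[OF equiv_cohomologous2 f] H2_zero_eq by auto
qed

text \<open>The requirement on \<open>\<theta>\<^sub>n = h\<close>, stated as \<open>E = \<delta> h\<close>. It depends on \<open>\<theta>\<close> only below \<open>n\<close>, as the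
  recursive choice of the \<open>\<theta>\<^sub>n\<close> demands.\<close>
definition deformation_step ::
  "('v \<Rightarrow> 'v \<Rightarrow> 'v) fps \<Rightarrow> (nat \<Rightarrow> 'v \<Rightarrow> 'v) \<Rightarrow> nat \<Rightarrow> ('v \<Rightarrow> 'v) \<Rightarrow> bool" where
  "deformation_step \<mu> \<theta> n h \<longleftrightarrow>
     Vector_Spaces.linear scale scale h \<and>
     (if n = 0 then h = id
      else \<forall>a b. obstruction \<mu> \<theta> n [a, b] = h (mul a b) - mul a (h b) - mul (h a) b)"

text \<open>Stated for arbitrary series \<open>x\<close>, \<open>y\<close> that agree with \<open>\<phi>\<^sub>t a\<close>, \<open>\<phi>\<^sub>t b\<close> up to degree \<open>m\<close>, so that it
  applies both to the truncations during the recursion and to the complete series at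
  the end.\<close>
lemma deformation_step_hom:
  assumes \<mu>: "formal_deformation \<mu>" and id: "\<theta> 0 = id" and step: "deformation_step \<mu> \<theta> m (\<theta> m)"
    and x: "\<And>k. k \<le> m \<Longrightarrow> x $ k = \<theta> k a" and y: "\<And>k. k \<le> m \<Longrightarrow> y $ k = \<theta> k b"
  shows "fps_apply2 \<mu> x y $ m = \<theta> m (mul a b)"
proof (cases "m = 0")
  case True
  then show ?thesis
    using x[of 0] y[of 0] id formal_deformationD(2)[OF \<mu>] by (simp add: fps_apply2_def)
next
  case False
  then have "fps_apply2 \<mu> x y $ m = obstruction \<mu> \<theta> m [a, b] + mul (\<theta> m a) b + mul a (\<theta> m b)"
    using fps_apply2_nth_perturb[OF formal_deformationD(1)[OF \<mu>], of m x "truncated_image \<theta> m a"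
        y "truncated_image \<theta> m b"] x y id
    by (simp add: truncated_image_nth obstruction_pair formal_deformationD(2)[OF \<mu>])
  then show ?thesis
    using step False by (simp add: deformation_step_def)
qed

lemma ex_deformation_steps:
  assumes \<mu>: "formal_deformation \<mu>" and H2: "H2 = {H2_zero}"
  shows "\<exists>\<theta>. \<forall>n. deformation_step \<mu> \<theta> n (\<theta> n)"
proof (rule dependent_wellorder_choice)
  fix h and \<theta> \<theta>' :: "nat \<Rightarrow> 'v \<Rightarrow> 'v" and n
  assume "\<And>m. m < n \<Longrightarrow> \<theta> m = \<theta>' m"
  then have "truncated_image \<theta> n = truncated_image \<theta>' n"
    by (auto simp: truncated_image_def fps_eq_iff)
  then show "deformation_step \<mu> \<theta> n h = deformation_step \<mu> \<theta>' n h"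
    by (simp add: deformation_step_def obstruction_pair)
next
  fix n \<theta>
  assume steps: "\<And>m. m < n \<Longrightarrow> deformation_step \<mu> \<theta> m (\<theta> m)"
  show "\<exists>h. deformation_step \<mu> \<theta> n h"
  proof (cases "n = 0")
    case True
    then show ?thesis
      using linear_scaleI[of id] by (auto simp: deformation_step_def)
  next
    case False
    have id: "\<theta> 0 = id"
      using steps[of 0] False by (simp add: deformation_step_def)
    have "obstruction \<mu> \<theta> n \<in> cocycles2"
    proof (rule obstruction_in_cocycles2[OF \<mu>])
      fix m a b assume "m < n"
      then show "fps_apply2 \<mu> (truncated_image \<theta> n a) (truncated_image \<theta> n b) $ m = \<theta> m (mul a b)"
        by (intro deformation_step_hom[OF \<mu> id steps]) (auto simp: truncated_image_nth)
    qed (use False id steps in \<open>auto simp: deformation_step_def\<close>)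
    then obtain f where f: "f \<in> cochains 1" and E: "obstruction \<mu> \<theta> n = delta 1 f"
      using cocycle_is_coboundary[OF H2] by (auto simp: coboundaries2_def)
    have "deformation_step \<mu> \<theta> n (\<lambda>x. f [x])"
      using False cochain_1_linear[OF f] by (simp add: deformation_step_def E delta_1[unfolded One_nat_def])
    then show ?thesis by blast
  qed
qed

section \<open>From constants to all series\<close>

lemma fps_apply_add:
  assumes "\<And>j. Vector_Spaces.linear scale scale (\<phi> $ j)"
  shows "fps_apply \<phi> (x + y) = fps_apply \<phi> x + fps_apply \<phi> y"
  using assms by (intro fps_ext) (simp add: fps_apply_def Vector_Spaces.linear_iff sum.distrib)

lemma fps_apply_up:
  assumes "\<And>j. Vector_Spaces.linear scale scale (\<phi> $ j)"
  shows "fps_apply \<phi> (fps_up x) = fps_up (fps_apply \<phi> x)"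
proof (rule fps_ext)
  fix n
  have "(\<phi> $ j) 0 = 0" for j
    using assms by (metis module_hom.zero module_hom_iff_linear)
  then show "fps_apply \<phi> (fps_up x) $ n = fps_up (fps_apply \<phi> x) $ n"
    by (cases n) (simp_all add: fps_apply_def Suc_diff_le)
qed

text \<open>The undeformed product is the constant deformation, so that it inherits additivity and
  compatibility with \<open>t\<close> from \<open>fps_apply2\<close>.\<close>
lemma mul_series_eq_fps_apply2:
  "mul_series = fps_apply2 (Abs_fps (\<lambda>i. if i = 0 then mul else (\<lambda>_ _. 0)))"
proof (intro ext fps_ext)
  fix x y n
  have "(\<Sum>i\<le>n. \<Sum>j\<le>n - i. (if i = 0 then mul else (\<lambda>_ _. 0)) (x $ j) (y $ (n - i - j)))
      = (\<Sum>i\<le>n. if i = 0 then \<Sum>j\<le>n. mul (x $ j) (y $ (n - j)) else 0)"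
    by (rule sum.cong) auto
  then show "mul_series x y $ n
      = fps_apply2 (Abs_fps (\<lambda>i. if i = 0 then mul else (\<lambda>_ _. 0))) x y $ n"
    by (simp add: mul_series_def fps_apply2_def)
qed

lemma bilinear_series_mul: "bilinear_series (Abs_fps (\<lambda>i. if i = 0 then mul else (\<lambda>_ _. 0)))"
  using linear_mul_left linear_mul_right linear_scaleI[of "\<lambda>_. 0"]
  by (auto simp: bilinear_series_def)

lemma mul_series_const: "mul_series (fps_const a) (fps_const b) = fps_const (mul a b)"
proof (rule fps_ext)
  fix n
  have "(\<Sum>i\<le>n. mul (fps_const a $ i) (fps_const b $ (n - i)))
      = (\<Sum>i\<le>n. if i = 0 then mul a (fps_const b $ n) else 0)"
    by (rule sum.cong) (auto simp: mul_zero_left)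
  then show "mul_series (fps_const a) (fps_const b) $ n = fps_const (mul a b) $ n"
    by (simp add: mul_series_def mul_zero_right)
qed

lemma fps_apply_const:
  assumes "\<And>j. Vector_Spaces.linear scale scale (\<phi> $ j)"
  shows "fps_apply \<phi> (fps_const a) $ n = (\<phi> $ n) a"
proof -
  have z: "(\<phi> $ j) 0 = 0" for j
    using assms by (metis module_hom.zero module_hom_iff_linear)
  have "(\<Sum>i\<le>n. (\<phi> $ i) (fps_const a $ (n - i))) = (\<Sum>i\<le>n. if i = n then (\<phi> $ n) a else 0)"
    by (rule sum.cong) (auto simp: z)
  then show ?thesis by (simp add: fps_apply_def)
qed

lemma fps_apply_hom:
  assumes \<mu>: "bilinear_series \<mu>" and \<phi>: "\<And>j. Vector_Spaces.linear scale scale (\<phi> $ j)"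
    and const: "\<And>a b. fps_apply2 \<mu> (fps_apply \<phi> (fps_const a)) (fps_apply \<phi> (fps_const b))
                     = fps_apply \<phi> (fps_const (mul a b))"
  shows "fps_apply2 \<mu> (fps_apply \<phi> x) (fps_apply \<phi> y) = fps_apply \<phi> (mul_series x y)"
proof -
  note simps = fps_apply_add[OF \<phi>] fps_apply_up[OF \<phi>] fps_apply2_add_left[OF \<mu>]
    fps_apply2_add_right[OF \<mu>] fps_apply2_up_left[OF \<mu>] fps_apply2_up_right[OF \<mu>]
    fps_apply2_add_left[OF bilinear_series_mul] fps_apply2_add_right[OF bilinear_series_mul]
    fps_apply2_up_left[OF bilinear_series_mul] fps_apply2_up_right[OF bilinear_series_mul]
  let ?D = "\<lambda>x y. fps_apply2 \<mu> (fps_apply \<phi> x) (fps_apply \<phi> y)"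
  let ?D' = "\<lambda>x y. fps_apply \<phi> (mul_series x y)"
  have linear: "?D (x + x') y = ?D x y + ?D x' y" "?D (fps_up x) y = fps_up (?D x y)"
    "?D x (y + y') = ?D x y + ?D x y'" "?D x (fps_up y) = fps_up (?D x y)"
    "?D' (x + x') y = ?D' x y + ?D' x' y" "?D' (fps_up x) y = fps_up (?D' x y)"
    "?D' x (y + y') = ?D' x y + ?D' x y'" "?D' x (fps_up y) = fps_up (?D' x y)" for x x' y y'
    unfolding mul_series_eq_fps_apply2 by (simp_all only: simps)
  have const_left: "?D (fps_const a) y = ?D' (fps_const a) y" for a y
    by (rule fps_maps_eqI[of "?D (fps_const a)"], rule linear, rule linear, rule linear,
        rule linear) (simp only: const mul_series_const)
  show ?thesis
    by (rule fps_maps_eqI[of "\<lambda>x. ?D x y"], rule linear, rule linear, rule linear, rule linear,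
        rule const_left)
qed

lemma H2_trivial_imp_trivial_deformation:
  assumes H2: "H2 = {H2_zero}" and \<mu>: "formal_deformation \<mu>"
  shows "trivial_deformation \<mu>"
proof -
  obtain \<theta> where \<theta>: "\<And>n. deformation_step \<mu> \<theta> n (\<theta> n)"
    using ex_deformation_steps[OF \<mu> H2] by blast
  define \<phi> where "\<phi> = Abs_fps \<theta>"
  have lin: "Vector_Spaces.linear scale scale (\<phi> $ j)" for j
    using \<theta>[of j] by (simp add: \<phi>_def deformation_step_def)
  have id: "\<theta> 0 = id"
    using \<theta>[of 0] by (simp add: deformation_step_def)
  have aut: "formal_automorphism \<phi>"
    using lin id by (simp add: formal_automorphism_def \<phi>_def)
  have "fps_apply2 \<mu> (fps_apply \<phi> (fps_const a)) (fps_apply \<phi> (fps_const b)) $ n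
      = fps_apply \<phi> (fps_const (mul a b)) $ n" for a b n
  proof -
    have orbit: "fps_apply \<phi> (fps_const c) $ k = \<theta> k c" for c k
      using fps_apply_const[OF lin] by (simp add: \<phi>_def)
    show ?thesis
      unfolding orbit by (rule deformation_step_hom[OF \<mu> id \<theta> orbit orbit])
  qed
  then have "fps_apply2 \<mu> (fps_apply \<phi> (fps_const a)) (fps_apply \<phi> (fps_const b))
      = fps_apply \<phi> (fps_const (mul a b))" for a b
    by (intro fps_ext)
  then have hom: "fps_apply2 \<mu> (fps_apply \<phi> x) (fps_apply \<phi> y) = fps_apply \<phi> (mul_series x y)" for x y
    by (rule fps_apply_hom[OF formal_deformationD(1)[OF \<mu>] lin])
  have "fps_apply2 \<mu> x y
      = fps_apply \<phi> (mul_series (inv (fps_apply \<phi>) x) (inv (fps_apply \<phi>) y))" for x y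
    using hom[of "inv (fps_apply \<phi>) x" "inv (fps_apply \<phi>) y"]
      surj_f_inv_f[OF bij_is_surj[OF bij_fps_apply[OF aut]]] by simp
  then show ?thesis
    using aut by (auto simp: trivial_deformation_def)
qed

end

theorem theorem6p1:
  fixes scale :: "'f::field_char_0 \<Rightarrow> 'v::ab_group_add \<Rightarrow> 'v"
    and mul :: "'v \<Rightarrow> 'v \<Rightarrow> 'v"
  assumes "kv_algebra scale mul"
    and "kv_algebra.H2 scale mul = {kv_algebra.H2_zero scale mul}"
  shows "kv_algebra.formally_rigid scale mul"
  using kv_algebra.H2_trivial_imp_trivial_deformation[OF assms]
  by (simp add: kv_algebra.formally_rigid_def[OF assms(1)])

end
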